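(* Let $S$ be a semiring and $M$ an $S$-semimodule such that $(M,+)$ is a group. If $S$ is classical, then the expectation semiring $S\widetilde{\oplus}M$ is also classical.
   Context: A semiring is an algebraic structure $(S,+,\cdot,0,1)$ such that $(S,+,0)$ and $(S,\cdot,1)$ are commutative monoids, multiplication distributes over addition, and $s\cdot 0=0$ for all $s\in S$. An $S$-semimodule is a commutative monoid $(M,+,0_M)$ with a scalar multiplication $S\times M\to M$ such that for all $s,t\in S$ and $m,n\in M$: $s(m+n)=sm+sn$; $(s+t)m=sm+tm$; $(st)m=s(tm)$; $s0_M=0_M$; $0_S m=0_M$; $1m=m$. The expectation semiring $S\widetilde{\oplus}M$ is the set $S\times M$ with operations $(s_1,m_1)+(s_2,m_2)=(s_1+s_2,m_1+m_2)$ and $(s_1,m_1)\cdot(s_2,m_2)=(s_1s_2,s_1m_2+s_2m_1)$. An element $s$ of a semiring is a unit if $st=1$ for some $t$; it is a zero-divisor if $sx=0$ for some nonzero $x$. A semiring is classical if each of its elements is either a unit or a zero-divisor. *)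

theory Defs
  imports "HOL-Algebra.Module"
begin

text \<open>
  The library's \<^locale>\<open>semiring\<close> does not require multiplication to be commutative.
  The trivial semiring with one = zero is allowed.
\<close>

locale comm_semiring = semiring R + comm_monoid R
  for R (structure)

text \<open>
  As in the library's \<^locale>\<open>module\<close>, the scalar multiplication and the additive structure of
  \<open>M\<close> live in a \<^type>\<open>module_scheme\<close> record whose multiplicative fields are ignored.
  The last two axioms follow from the others when \<open>M\<close> is a group, but not in general.
\<close>

locale semimodule = R?: comm_semiring R + M?: abelian_monoid M
  for R (structure) and M (structure) +
  assumes smult_closed [simp, intro]:
      "\<lbrakk> a \<in> carrier R; x \<in> carrier M \<rbrakk> \<Longrightarrow> a \<odot>\<^bsub>M\<^esub> x \<in> carrier M"
    and smult_r_distr: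
      "\<lbrakk> a \<in> carrier R; x \<in> carrier M; y \<in> carrier M \<rbrakk> \<Longrightarrow>
        a \<odot>\<^bsub>M\<^esub> (x \<oplus>\<^bsub>M\<^esub> y) = a \<odot>\<^bsub>M\<^esub> x \<oplus>\<^bsub>M\<^esub> a \<odot>\<^bsub>M\<^esub> y"
    and smult_l_distr:
      "\<lbrakk> a \<in> carrier R; b \<in> carrier R; x \<in> carrier M \<rbrakk> \<Longrightarrow>
        (a \<oplus> b) \<odot>\<^bsub>M\<^esub> x = a \<odot>\<^bsub>M\<^esub> x \<oplus>\<^bsub>M\<^esub> b \<odot>\<^bsub>M\<^esub> x"
    and smult_assoc1:
      "\<lbrakk> a \<in> carrier R; b \<in> carrier R; x \<in> carrier M \<rbrakk> \<Longrightarrow>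
        (a \<otimes> b) \<odot>\<^bsub>M\<^esub> x = a \<odot>\<^bsub>M\<^esub> (b \<odot>\<^bsub>M\<^esub> x)"
    and smult_one [simp]:
      "x \<in> carrier M \<Longrightarrow> \<one> \<odot>\<^bsub>M\<^esub> x = x"
    and smult_r_null [simp]:
      "a \<in> carrier R \<Longrightarrow> a \<odot>\<^bsub>M\<^esub> \<zero>\<^bsub>M\<^esub> = \<zero>\<^bsub>M\<^esub>"
    and smult_l_null [simp]:
      "x \<in> carrier M \<Longrightarrow> \<zero> \<odot>\<^bsub>M\<^esub> x = \<zero>\<^bsub>M\<^esub>"

definition expectation_semiring ::
  "('a, 'r) ring_scheme \<Rightarrow> ('a, 'b, 'm) module_scheme \<Rightarrow> ('a \<times> 'b) ring"
  where "expectation_semiring S M =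
    \<lparr> carrier = carrier S \<times> carrier M,
      monoid.mult = (\<lambda>(s\<^sub>1, m\<^sub>1) (s\<^sub>2, m\<^sub>2).
        (s\<^sub>1 \<otimes>\<^bsub>S\<^esub> s\<^sub>2, (s\<^sub>1 \<odot>\<^bsub>M\<^esub> m\<^sub>2) \<oplus>\<^bsub>M\<^esub> (s\<^sub>2 \<odot>\<^bsub>M\<^esub> m\<^sub>1))),
      one = (\<one>\<^bsub>S\<^esub>, \<zero>\<^bsub>M\<^esub>),
      zero = (\<zero>\<^bsub>S\<^esub>, \<zero>\<^bsub>M\<^esub>),
      add = (\<lambda>(s\<^sub>1, m\<^sub>1) (s\<^sub>2, m\<^sub>2). (s\<^sub>1 \<oplus>\<^bsub>S\<^esub> s\<^sub>2, m\<^sub>1 \<oplus>\<^bsub>M\<^esub> m\<^sub>2)) \<rparr>"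

definition zero_divisor :: "('a, 'r) ring_scheme \<Rightarrow> 'a \<Rightarrow> bool"
  where "zero_divisor R s \<longleftrightarrow>
    s \<in> carrier R \<and> (\<exists>x \<in> carrier R. x \<noteq> \<zero>\<^bsub>R\<^esub> \<and> s \<otimes>\<^bsub>R\<^esub> x = \<zero>\<^bsub>R\<^esub>)"

locale classical_semiring = comm_semiring R
  for R (structure) +
  assumes unit_or_zero_divisor: "s \<in> carrier R \<Longrightarrow> s \<in> Units R \<or> zero_divisor R s"

lemma (in semimodule) comm_semiring_expectation_semiring:
  "comm_semiring (expectation_semiring R M)"
proof -
  have "abelian_monoid (expectation_semiring R M)"
    by (rule abelian_monoidI)
      (auto simp: expectation_semiring_def R.a_ac M.a_ac)
  moreover have "comm_monoid (expectation_semiring R M)"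
    by (rule comm_monoidI)
      (auto simp: expectation_semiring_def R.m_ac smult_r_distr smult_assoc1 [symmetric]
        M.a_ac)
  moreover have "semiring_axioms (expectation_semiring R M)"
    by unfold_locales
      (auto simp: expectation_semiring_def R.l_distr R.r_distr smult_r_distr smult_l_distr M.a_ac)
  ultimately show ?thesis
    by (simp add: comm_semiring_def semiring_def comm_monoid.axioms)
qed

end

theory Submission
  imports Defs
begin

text \<open>
  An element \<open>(s, m)\<close> of the expectation semiring inherits its type from \<open>s\<close>.
  If \<open>s t = 1\<close>, then the formula \<open>(1/s, - m/s\<^sup>2)\<close> familiar from derivatives and dual numbers
  gives an inverse \<open>(t, - t(t m))\<close>; this step uses that \<open>M\<close> has negatives. If \<open>s x = 0\<close> with
  \<open>x \<noteq> 0\<close>, then \<open>(s, m) (x, 0) = (0, x m)\<close>. Either this is zero, and \<open>(x, 0)\<close> is a nonzero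
  annihilator of \<open>(s, m)\<close>; or \<open>(0, x m)\<close> is itself a nonzero annihilator, because
  \<open>(s, m) (0, x m) = (0, (s x) m) = 0\<close>.
\<close>

context semimodule
begin

text \<open>
  Written with \<open>n = - m\<close>, the inverse \<open>(t, t(t n))\<close> makes the second component of the product
  collapse to \<open>t n + t m = t (n + m) = 0\<close>.
\<close>

lemma expectation_semiring_UnitsI:
  assumes s: "s \<in> Units R" and m: "m \<in> carrier M"
    and n: "n \<in> carrier M" and mn: "n \<oplus>\<^bsub>M\<^esub> m = \<zero>\<^bsub>M\<^esub>"
  shows "(s, m) \<in> Units (expectation_semiring R M)"
proof -
  let ?E = "expectation_semiring R M"
  interpret E: comm_semiring ?E
    by (rule comm_semiring_expectation_semiring)
  obtain t where t: "t \<in> carrier R" "s \<otimes> t = \<one>" and sc: "s \<in> carrier R"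
    using s by (auto simp: Units_def)
  have "s \<odot>\<^bsub>M\<^esub> (t \<odot>\<^bsub>M\<^esub> (t \<odot>\<^bsub>M\<^esub> n)) \<oplus>\<^bsub>M\<^esub> t \<odot>\<^bsub>M\<^esub> m = t \<odot>\<^bsub>M\<^esub> n \<oplus>\<^bsub>M\<^esub> t \<odot>\<^bsub>M\<^esub> m"
    using t sc n by (simp flip: smult_assoc1 [of s t])
  also have "\<dots> = \<zero>\<^bsub>M\<^esub>"
    using t m n mn by (simp flip: smult_r_distr)
  finally have right_inverse: "(s, m) \<otimes>\<^bsub>?E\<^esub> (t, t \<odot>\<^bsub>M\<^esub> (t \<odot>\<^bsub>M\<^esub> n)) = \<one>\<^bsub>?E\<^esub>"
    using t by (simp add: expectation_semiring_def)
  have closed: "(s, m) \<in> carrier ?E" "(t, t \<odot>\<^bsub>M\<^esub> (t \<odot>\<^bsub>M\<^esub> n)) \<in> carrier ?E"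
    using sc t m n by (simp_all add: expectation_semiring_def)
  show ?thesis
    unfolding Units_def
    using right_inverse E.m_comm [OF closed] closed by auto
qed

lemma expectation_semiring_zero_divisorI:
  assumes s: "zero_divisor R s" and m: "m \<in> carrier M"
  shows "zero_divisor (expectation_semiring R M) (s, m)"
proof -
  let ?E = "expectation_semiring R M"
  obtain x where x: "x \<in> carrier R" "x \<noteq> \<zero>" "s \<otimes> x = \<zero>" and sc: "s \<in> carrier R"
    using s by (auto simp: zero_divisor_def)
  have "\<exists>y \<in> carrier ?E. y \<noteq> \<zero>\<^bsub>?E\<^esub> \<and> (s, m) \<otimes>\<^bsub>?E\<^esub> y = \<zero>\<^bsub>?E\<^esub>"
  proof (cases "x \<odot>\<^bsub>M\<^esub> m = \<zero>\<^bsub>M\<^esub>")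
    case True
    then show ?thesis
      using x sc m by (intro bexI [of _ "(x, \<zero>\<^bsub>M\<^esub>)"]) (auto simp: expectation_semiring_def)
  next
    case False
    have "s \<odot>\<^bsub>M\<^esub> (x \<odot>\<^bsub>M\<^esub> m) = \<zero>\<^bsub>M\<^esub>"
      using x sc m by (simp flip: smult_assoc1)
    then show ?thesis
      using False x sc m
      by (intro bexI [of _ "(\<zero>, x \<odot>\<^bsub>M\<^esub> m)"]) (auto simp: expectation_semiring_def)
  qed
  then show ?thesis
    using sc m by (simp add: zero_divisor_def expectation_semiring_def)
qed

end

theorem proposition3p16:
  fixes S :: "('a, 'r) ring_scheme" and M :: "('a, 'b, 'm) module_scheme"
  assumes "semimodule S M"
    and "group (add_monoid M)"
    and "classical_semiring S"
  shows "classical_semiring (expectation_semiring S M)"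
proof -
  let ?E = "expectation_semiring S M"
  interpret semimodule S M by fact
  interpret S: classical_semiring S by fact
  have negative: "\<exists>n \<in> carrier M. n \<oplus>\<^bsub>M\<^esub> m = \<zero>\<^bsub>M\<^esub>" if "m \<in> carrier M" for m
    using group.l_inv_ex [OF assms(2)] that by simp
  have "p \<in> Units ?E \<or> zero_divisor ?E p" if pE: "p \<in> carrier ?E" for p
  proof -
    obtain s m where p: "p = (s, m)" and s: "s \<in> carrier S" and m: "m \<in> carrier M"
      using pE by (auto simp: expectation_semiring_def)
    from S.unit_or_zero_divisor [OF s] show ?thesis
      using negative [OF m] expectation_semiring_UnitsI [of s m]
        expectation_semiring_zero_divisorI [of s m] m p by blast
  qed
  then show ?thesis
    using comm_semiring_expectation_semiring
    by (simp add: classical_semiring_def classical_semiring_axioms_def)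
qed

end
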